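(* Let $(M,\mathcal{M},\mu)$ be a $\sigma$-finite measure space, $\mathfrak{Z}$ an $\mathbb{F}$-Fréchet space, and $\psi:M\to\mathfrak{Z}'$ a $\mathfrak{Z}'$-Gelfand $\mu$-integrable map. Then the map $[E]\mapsto\int_E\psi(x)\,\mu(dx)$ is continuous from $(\mathcal{M}/{\sim},d_\mu)$ into $(\mathfrak{Z}',\sigma(\mathfrak{Z}',\mathfrak{Z}))$, i.e. weak star continuous.
   Context: $\mathbb{F}\in\{\mathbb{R},\mathbb{C}\}$. A Fréchet space is a metrizable, complete, locally convex topological vector space over $\mathbb{F}$; $\mathfrak{Z}'$ is its topological dual and $\langle z',z\rangle$ the dual pairing of $z'\in\mathfrak{Z}'$, $z\in\mathfrak{Z}$. $\sigma(\mathfrak{Z}',\mathfrak{Z})$ is the weak star topology on $\mathfrak{Z}'$, i.e. the coarsest topology making all maps $z'\mapsto\langle z',z\rangle$, $z\in\mathfrak{Z}$, continuous. A map $\psi:M\to\mathfrak{Z}'$ is $\mathfrak{Z}'$-Gelfand $\mu$-integrable if $x\mapsto\langle\psi(x),z\rangle$ belongs to $L^1(\mu)$ for every $z\in\mathfrak{Z}$. For such $\psi$ and $E\in\mathcal{M}$, the Gelfand integral $\int_E\psi(x)\,\mu(dx)$ is the element of $\mathfrak{Z}'$ given by $z\mapsto\int_E\langle\psi(x),z\rangle\,\mu(dx)$ (this functional is continuous). The relation $\sim$ on $\mathcal{M}$ is $E\sim\tilde{E}$ iff $\mu(E\Delta\tilde{E})=0$, where $\Delta$ is symmetric difference; $[E]$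 is the class of $E$. The Fréchet–Nikodym metric on $\mathcal{M}/{\sim}$ is $d_\mu([E],[\tilde{E}]):=\mu(E\Delta\tilde{E})\in[0,\infty]$ (the value $\infty$ is allowed). The integral $\int_E\psi\,d\mu$ depends only on the class $[E]$. *)

theory Defs
  imports "HOL-Analysis.Analysis"
begin

section \<open>Scalars\<close>

text \<open>The scalar field is the real or the complex numbers. In the second case the norm
  is the usual absolute value, being multiplicative and extending the one on the reals.\<close>

class real_or_complex = real_normed_field + banach + second_countable_topology +
  assumes real_or_complex:
    "(\<forall>z. \<exists>a. z = a *\<^sub>R 1) \<or> (\<exists>i. i * i = - 1 \<and> (\<forall>z. \<exists>a b. z = a *\<^sub>R 1 + b *\<^sub>R i))"

instance real :: real_or_complex
  by standard simp

instance complex :: real_or_complex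
proof
  have "\<forall>z. \<exists>a b. z = a *\<^sub>R 1 + b *\<^sub>R \<i>"
    by (auto simp: complex_eq_iff)
  then show "(\<forall>z::complex. \<exists>a. z = a *\<^sub>R 1) \<or>
      (\<exists>i::complex. i * i = - 1 \<and> (\<forall>z. \<exists>a b. z = a *\<^sub>R 1 + b *\<^sub>R i))"
    by (intro disjI2 exI[of _ \<i>]) auto
qed


section \<open>Frechet spaces and their duals\<close>

text \<open>The type class of \<open>'z\<close> provides continuity of addition and negation. Completeness
  refers to the translation-invariant uniformity of the topological vector space: every Cauchy
  filter converges.\<close>

locale frechet_space = vector_space smul
  for smul :: "'k::real_or_complex \<Rightarrow> 'z::topological_ab_group_add \<Rightarrow> 'z" +
  assumes continuous_smul: "continuous_on UNIV (\<lambda>(a, z). smul a z)"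
    and metrizable: "metrizable_space (euclidean :: 'z topology)"
    and locally_convex:
      "\<And>U. open U \<Longrightarrow> 0 \<in> U \<Longrightarrow>
        \<exists>C. C \<subseteq> U \<and> 0 \<in> interior C \<and>
          (\<forall>x\<in>C. \<forall>y\<in>C. \<forall>t\<in>{0..1::real}. smul (of_real (1 - t)) x + smul (of_real t) y \<in> C)"
    and complete:
      "\<And>F :: 'z filter. F \<noteq> bot \<Longrightarrow>
        filterlim (\<lambda>(x, y). x - y) (nhds 0) (F \<times>\<^sub>F F) \<Longrightarrow> \<exists>z. F \<le> nhds z"

definition topological_dual ::
    "('k::real_or_complex \<Rightarrow> 'z::topological_ab_group_add \<Rightarrow> 'z) \<Rightarrow> ('z \<Rightarrow> 'k) set" where
  "topological_dual smul = {f. Vector_Spaces.linear smul (*) f \<and> continuous_on UNIV f}"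

definition weak_star_topology ::
    "('k::real_or_complex \<Rightarrow> 'z::topological_ab_group_add \<Rightarrow> 'z) \<Rightarrow> ('z \<Rightarrow> 'k) topology" where
  "weak_star_topology smul =
    topology_generated_by {{f \<in> topological_dual smul. f z \<in> U} | z U. open U}"

lemma topspace_weak_star_topology [simp]:
  "topspace (weak_star_topology smul) = topological_dual smul"
  unfolding weak_star_topology_def topology_generated_by_topspace by auto


section \<open>The Gelfand integral\<close>

definition gelfand_integrable ::
    "('k::real_or_complex \<Rightarrow> 'z::topological_ab_group_add \<Rightarrow> 'z) \<Rightarrow> 'm measure \<Rightarrow>
      ('m \<Rightarrow> 'z \<Rightarrow> 'k) \<Rightarrow> bool" where
  "gelfand_integrable smul M \<psi> \<longleftrightarrow>
    \<psi> \<in> space M \<rightarrow> topological_dual smul \<and> (\<forall>z. integrable M (\<lambda>x. \<psi> x z))"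

definition gelfand_integral ::
    "'m measure \<Rightarrow> ('m \<Rightarrow> 'z \<Rightarrow> 'k::real_or_complex) \<Rightarrow> 'm set \<Rightarrow> 'z \<Rightarrow> 'k" where
  "gelfand_integral M \<psi> E = (\<lambda>z. LINT x:E|M. \<psi> x z)"


section \<open>The Frechet--Nikodym space\<close>

definition null_diff_rel :: "'m measure \<Rightarrow> ('m set \<times> 'm set) set" where
  "null_diff_rel M = {(E, F). E \<in> sets M \<and> F \<in> sets M \<and> emeasure M (sym_diff E F) = 0}"

definition frechet_nikodym_space :: "'m measure \<Rightarrow> 'm set set set" where
  "frechet_nikodym_space M = sets M // null_diff_rel M"

text \<open>\<open>the_elem\<close> picks the value common to all representatives; that there is exactly one
  such value is shown in \<open>frechet_nikodym_dist_class\<close> and \<open>gelfand_integral_class_class\<close>.\<close>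

definition frechet_nikodym_dist :: "'m measure \<Rightarrow> 'm set set \<Rightarrow> 'm set set \<Rightarrow> ennreal" where
  "frechet_nikodym_dist M A B = the_elem ((\<lambda>(E, F). emeasure M (sym_diff E F)) ` (A \<times> B))"

definition gelfand_integral_class ::
    "'m measure \<Rightarrow> ('m \<Rightarrow> 'z \<Rightarrow> 'k::real_or_complex) \<Rightarrow> 'm set set \<Rightarrow> 'z \<Rightarrow> 'k" where
  "gelfand_integral_class M \<psi> A = the_elem (gelfand_integral M \<psi> ` A)"

text \<open>The library's metric spaces have real-valued distances, hence the topology of the
  extended metric is spelled out.\<close>

definition frechet_nikodym_topology :: "'m measure \<Rightarrow> 'm set set topology" where
  "frechet_nikodym_topology M =
    topology (\<lambda>U. U \<subseteq> frechet_nikodym_space M \<and>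
      (\<forall>A\<in>U. \<exists>e>0. \<forall>B\<in>frechet_nikodym_space M. frechet_nikodym_dist M A B < e \<longrightarrow> B \<in> U))"

lemma emeasure_sym_diff_triangle:
  assumes "E \<in> sets M" "F \<in> sets M" "G \<in> sets M"
  shows "emeasure M (sym_diff E G) \<le> emeasure M (sym_diff E F) + emeasure M (sym_diff F G)"
proof -
  have "emeasure M (sym_diff E G) \<le> emeasure M (sym_diff E F \<union> sym_diff F G)"
    using assms by (intro emeasure_mono) auto
  also have "\<dots> \<le> emeasure M (sym_diff E F) + emeasure M (sym_diff F G)"
    using assms by (intro emeasure_subadditive) auto
  finally show ?thesis .
qed

lemma emeasure_sym_diff_commute: "emeasure M (sym_diff E F) = emeasure M (sym_diff F E)"
  by (simp add: Un_commute)

lemma equiv_null_diff_rel: "equiv (sets M) (null_diff_rel M)"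
proof (rule equivI)
  show "null_diff_rel M \<subseteq> sets M \<times> sets M"
    by (auto simp: null_diff_rel_def)
  show "refl_on (sets M) (null_diff_rel M)"
    by (auto simp: refl_on_def null_diff_rel_def)
  show "sym (null_diff_rel M)"
    by (auto simp: sym_def null_diff_rel_def Un_commute)
  show "trans (null_diff_rel M)"
  proof (rule transI)
    fix E F G assume "(E, F) \<in> null_diff_rel M" "(F, G) \<in> null_diff_rel M"
    then show "(E, G) \<in> null_diff_rel M"
      using emeasure_sym_diff_triangle[of E M F G] by (auto simp: null_diff_rel_def)
  qed
qed

lemma frechet_nikodym_dist_class:
  assumes "E \<in> sets M" "F \<in> sets M"
  shows "frechet_nikodym_dist M (null_diff_rel M `` {E}) (null_diff_rel M `` {F}) =
    emeasure M (sym_diff E F)"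
proof -
  have le: "emeasure M (sym_diff E' F') \<le> emeasure M (sym_diff E F)"
    if "(E, E') \<in> null_diff_rel M" "(F, F') \<in> null_diff_rel M" for E E' F F'
  proof -
    have s: "E \<in> sets M" "E' \<in> sets M" "F \<in> sets M" "F' \<in> sets M"
      and z: "emeasure M (sym_diff E' E) = 0" "emeasure M (sym_diff F F') = 0"
      using that by (auto simp: null_diff_rel_def Un_commute)
    have "emeasure M (sym_diff E' F') \<le> emeasure M (sym_diff E' E) + emeasure M (sym_diff E F')"
      using s by (intro emeasure_sym_diff_triangle)
    also have "\<dots> \<le> 0 + (emeasure M (sym_diff E F) + emeasure M (sym_diff F F'))"
      unfolding z(1) using s by (intro add_left_mono emeasure_sym_diff_triangle)
    finally show ?thesis by (simp add: z(2))
  qed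
  have sy: "(B, A) \<in> null_diff_rel M" if "(A, B) \<in> null_diff_rel M" for A B
    using that equiv_null_diff_rel[of M] by (meson equivE symD)
  have eq: "emeasure M (sym_diff E' F') = emeasure M (sym_diff E F)"
    if "(E, E') \<in> null_diff_rel M" "(F, F') \<in> null_diff_rel M" for E' F'
    using le[OF that] le[OF sy[OF that(1)] sy[OF that(2)]] by (rule antisym)
  have "(E, E) \<in> null_diff_rel M" "(F, F) \<in> null_diff_rel M"
    using assms by (auto simp: null_diff_rel_def)
  then have ne: "null_diff_rel M `` {E} \<times> null_diff_rel M `` {F} \<noteq> {}"
    by blast
  have "the_elem ((\<lambda>(E, F). emeasure M (sym_diff E F)) `
      (null_diff_rel M `` {E} \<times> null_diff_rel M `` {F})) =
      (\<lambda>(E, F). emeasure M (sym_diff E F)) (E, F)"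
    using ne
  proof (rule the_elem_image_unique)
    fix p assume "p \<in> null_diff_rel M `` {E} \<times> null_diff_rel M `` {F}"
    then obtain E' F' where p: "p = (E', F')" "(E, E') \<in> null_diff_rel M" "(F, F') \<in> null_diff_rel M"
      by blast
    show "(\<lambda>(E, F). emeasure M (sym_diff E F)) p = (\<lambda>(E, F). emeasure M (sym_diff E F)) (E, F)"
      unfolding p(1) prod.case by (rule eq[OF p(2,3)])
  qed
  then show ?thesis
    by (simp only: frechet_nikodym_dist_def prod.case)
qed

lemma gelfand_integral_class_class:
  assumes "gelfand_integrable smul M \<psi>" "E \<in> sets M"
  shows "gelfand_integral_class M \<psi> (null_diff_rel M `` {E}) = gelfand_integral M \<psi> E"
proof -
  have eq: "gelfand_integral M \<psi> F = gelfand_integral M \<psi> E"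
    if "(E, F) \<in> null_diff_rel M" for F
  proof
    fix z
    have s: "E \<in> sets M" "F \<in> sets M" "sym_diff E F \<in> null_sets M"
      using that by (auto simp: null_diff_rel_def null_sets_def)
    have m: "(\<lambda>x. \<psi> x z) \<in> borel_measurable M"
      using assms(1) by (auto simp: gelfand_integrable_def intro: borel_measurable_integrable)
    have "AE x in M. x \<notin> sym_diff E F"
      using s(3) by (rule AE_not_in)
    then have "AE x in M. indicator F x *\<^sub>R \<psi> x z = indicator E x *\<^sub>R \<psi> x z"
      by eventually_elim (auto simp: indicator_def)
    then show "gelfand_integral M \<psi> F z = gelfand_integral M \<psi> E z"
      unfolding gelfand_integral_def set_lebesgue_integral_def
      using s m by (intro integral_cong_AE) auto
  qed
  have "(E, E) \<in> null_diff_rel M"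
    using assms by (auto simp: null_diff_rel_def)
  then have ne: "null_diff_rel M `` {E} \<noteq> {}"
    by blast
  show ?thesis
    unfolding gelfand_integral_class_def
    using ne by (rule the_elem_image_unique) (rule eq, simp)
qed

lemma openin_frechet_nikodym_topology:
  "openin (frechet_nikodym_topology M) U \<longleftrightarrow>
    U \<subseteq> frechet_nikodym_space M \<and>
    (\<forall>A\<in>U. \<exists>e>0. \<forall>B\<in>frechet_nikodym_space M. frechet_nikodym_dist M A B < e \<longrightarrow> B \<in> U)"
proof -
  have "istopology (\<lambda>U. U \<subseteq> frechet_nikodym_space M \<and>
      (\<forall>A\<in>U. \<exists>e>0. \<forall>B\<in>frechet_nikodym_space M. frechet_nikodym_dist M A B < e \<longrightarrow> B \<in> U))"
    (is "istopology ?P")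
    unfolding istopology_def
  proof (intro conjI allI impI)
    fix S T assume S: "?P S" and T: "?P T"
    show "S \<inter> T \<subseteq> frechet_nikodym_space M" using S by auto
    show "\<forall>A\<in>S \<inter> T. \<exists>e>0. \<forall>B\<in>frechet_nikodym_space M.
        frechet_nikodym_dist M A B < e \<longrightarrow> B \<in> S \<inter> T"
    proof
      fix A assume "A \<in> S \<inter> T"
      then obtain d e where "d > 0" "e > 0"
        "\<forall>B\<in>frechet_nikodym_space M. frechet_nikodym_dist M A B < d \<longrightarrow> B \<in> S"
        "\<forall>B\<in>frechet_nikodym_space M. frechet_nikodym_dist M A B < e \<longrightarrow> B \<in> T"
        using S T by blast
      then show "\<exists>e>0. \<forall>B\<in>frechet_nikodym_space M.
          frechet_nikodym_dist M A B < e \<longrightarrow> B \<in> S \<inter> T"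
        by (intro exI[of _ "min d e"]) auto
    qed
  next
    fix \<K> assume K: "\<forall>K\<in>\<K>. ?P K"
    show "\<Union>\<K> \<subseteq> frechet_nikodym_space M" using K by blast
    show "\<forall>A\<in>\<Union>\<K>. \<exists>e>0. \<forall>B\<in>frechet_nikodym_space M.
        frechet_nikodym_dist M A B < e \<longrightarrow> B \<in> \<Union>\<K>"
    proof
      fix A assume "A \<in> \<Union>\<K>"
      then obtain K where "K \<in> \<K>" "A \<in> K" by blast
      then obtain e where "e > 0"
        "\<forall>B\<in>frechet_nikodym_space M. frechet_nikodym_dist M A B < e \<longrightarrow> B \<in> K"
        using K by blast
      then show "\<exists>e>0. \<forall>B\<in>frechet_nikodym_space M.
          frechet_nikodym_dist M A B < e \<longrightarrow> B \<in> \<Union>\<K>"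
        using \<open>K \<in> \<K>\<close> by blast
    qed
  qed
  then show ?thesis
    by (simp add: frechet_nikodym_topology_def topology_inverse')
qed

lemma topspace_frechet_nikodym_topology [simp]:
  "topspace (frechet_nikodym_topology M) = frechet_nikodym_space M"
proof (rule antisym)
  show "topspace (frechet_nikodym_topology M) \<subseteq> frechet_nikodym_space M"
    using openin_topspace[of "frechet_nikodym_topology M"]
    unfolding openin_frechet_nikodym_topology by blast
  have "openin (frechet_nikodym_topology M) (frechet_nikodym_space M)"
    unfolding openin_frechet_nikodym_topology by (auto intro: exI[of _ 1])
  then show "frechet_nikodym_space M \<subseteq> topspace (frechet_nikodym_topology M)"
    by (rule openin_subset)
qed

end

theory Submission
  imports Defs
begin

text \<open>
  Two things have to be shown. First, each value \<open>\<integral>\<^sub>E \<psi> d\<mu>\<close> is a continuous functional. It is dominated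
  by the seminorm \<open>N z = \<integral> |\<langle>\<psi>(x), z\<rangle>| \<mu>(dx)\<close>, whose sublevel sets are closed by Fatou's lemma. These
  sets exhaust the space, so by Baire's theorem one of them has an interior point; by symmetry and
  subadditivity \<open>N\<close> is then bounded near the origin, and by homogeneity it is continuous there
  (\<open>lower_semicontinuous_seminorm_tendsto_zero\<close>). Baire's theorem is proved directly for metrizable
  topological groups in which Cauchy filters converge (\<open>baire_complete_group\<close>), since the metric
  need not be compatible with the group structure.

  Second, weak star continuity concerns one \<open>z\<close> at a time, and for fixed \<open>z\<close> the difference of the
  values at \<open>E\<close> and \<open>F\<close> is at most \<open>\<integral> |\<langle>\<psi>(x), z\<rangle>| \<mu>(dx)\<close> over the symmetric difference of \<open>E\<close> and \<open>F\<close>.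
  This is small by absolute continuity of the integral (\<open>integral_absolutely_continuous\<close>).
\<close>

section \<open>Absolute continuity of the integral\<close>

lemma integral_absolutely_continuous:
  fixes f :: "'a \<Rightarrow> real"
  assumes f: "integrable M f" and nonneg: "\<And>x. 0 \<le> f x" and "0 < e"
  obtains d where "0 < d" "\<And>A. A \<in> sets M \<Longrightarrow> emeasure M A < ennreal d \<Longrightarrow> (LINT x:A|M. f x) < e"
proof -
  have [measurable]: "f \<in> borel_measurable M"
    using f by auto
  have int_min: "integrable M (\<lambda>x. min (f x) (real n))" for n
    using nonneg by (intro Bochner_Integration.integrable_bound[OF f]) (auto simp: min_def)
  have "(\<lambda>n. \<integral>x. min (f x) (real n) \<partial>M) \<longlonglongrightarrow> (\<integral>x. f x \<partial>M)"
  proof (rule integral_dominated_convergence[where w = f])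
    show "AE x in M. (\<lambda>n. min (f x) (real n)) \<longlonglongrightarrow> f x"
    proof (intro AE_I2 tendsto_eventually)
      fix x
      obtain k where "f x \<le> real k"
        using real_arch_simple by blast
      then show "\<forall>\<^sub>F n in sequentially. min (f x) (real n) = f x"
        by (intro eventually_sequentiallyI[of k]) auto
    qed
  qed (use f nonneg in auto)
  then have "\<forall>\<^sub>F n in sequentially. dist (\<integral>x. min (f x) (real n) \<partial>M) (\<integral>x. f x \<partial>M) < e / 2"
    using \<open>0 < e\<close> by (intro tendstoD) auto
  then obtain n where "dist (\<integral>x. min (f x) (real n) \<partial>M) (\<integral>x. f x \<partial>M) < e / 2"
    by (auto simp: eventually_sequentially)
  then have tail: "(\<integral>x. f x - min (f x) (real n) \<partial>M) < e / 2"
    unfolding Bochner_Integration.integral_diff[OF f int_min] dist_real_def abs_less_iff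
    by linarith
  \<comment> \<open>On \<open>A\<close> the function is at most \<open>n\<close> plus its excess over \<open>n\<close>, and the excess has integral below
    \<open>e / 2\<close>; so \<open>n * d \<le> e / 2\<close> is what is needed. The summand 1 avoids division by zero.\<close>
  define d where "d = e / (2 * (real n + 1))"
  have "0 < d"
    using \<open>0 < e\<close> by (simp add: d_def)
  moreover have "(LINT x:A|M. f x) < e"
    if A[measurable]: "A \<in> sets M" and small: "emeasure M A < ennreal d" for A
  proof -
    have fin: "emeasure M A < \<infinity>"
      using small by (rule less_trans) simp
    then have mA: "measure M A \<le> d"
      using small \<open>0 < d\<close> by (simp add: measure_def enn2real_leI)
    have int_A: "integrable M (\<lambda>x. real n * indicator A x)"
      using fin A by simp
    have "(LINT x:A|M. f x) \<le> (\<integral>x. (f x - min (f x) (real n)) + real n * indicator A x \<partial>M)"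
      unfolding set_lebesgue_integral_def
    proof (rule integral_mono)
      show "integrable M (\<lambda>x. indicator A x *\<^sub>R f x)"
        using integrable_mult_indicator[OF A f] .
    qed (use f int_min int_A in \<open>auto simp: indicator_def\<close>)
    also have "\<dots> = (\<integral>x. f x - min (f x) (real n) \<partial>M) + real n * measure M A"
      using f int_min int_A A sets.sets_into_space[OF A]
      by (subst Bochner_Integration.integral_add) (auto simp: Int_absorb2)
    also have "\<dots> < e / 2 + real n * d"
      using tail mA by (intro add_less_le_mono mult_left_mono) auto
    also have "\<dots> \<le> e"
      using \<open>0 < e\<close> by (simp add: d_def field_simps)
    finally show ?thesis .
  qed
  ultimately show ?thesis
    using that by blast
qed

section \<open>Baire's theorem and lower semicontinuous seminorms\<close>

text \<open>A metric for the topology may be taken on the whole type.\<close>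

lemma metrizable_euclideanE:
  assumes "metrizable_space (euclidean :: 'a::topological_space topology)"
  obtains d where "Metric_space (UNIV :: 'a set) d" "Metric_space.mtopology UNIV d = euclidean"
proof -
  obtain S and d :: "'a \<Rightarrow> 'a \<Rightarrow> real" where d: "Metric_space S d"
    and top_eq: "euclidean = Metric_space.mtopology S d"
    using assms by (auto simp: metrizable_space_def)
  then have "S = UNIV"
    using Metric_space.topspace_mtopology by (metis topspace_euclidean)
  with d top_eq show ?thesis
    by (intro that) auto
qed

text \<open>Shrinking the balls so that the differences of their points tend to zero makes the sequence of
  centres Cauchy for the group uniformity, whatever the chosen metric is.\<close>

lemma baire_complete_group:
  fixes G :: "nat \<Rightarrow> 'z::topological_ab_group_add set"
  assumes metrizable: "metrizable_space (euclidean :: 'z topology)"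
    and complete: "\<And>F :: 'z filter. F \<noteq> bot \<Longrightarrow>
        filterlim (\<lambda>(x, y). x - y) (nhds 0) (F \<times>\<^sub>F F) \<Longrightarrow> \<exists>z. F \<le> nhds z"
    and open_G: "\<And>n. open (G n)"
    and dense_G: "\<And>n U. open U \<Longrightarrow> U \<noteq> {} \<Longrightarrow> U \<inter> G n \<noteq> {}"
  shows "(\<Inter>n. G n) \<noteq> {}"
proof -
  obtain d :: "'z \<Rightarrow> 'z \<Rightarrow> real" where "Metric_space UNIV d"
    and top_eq: "Metric_space.mtopology UNIV d = euclidean"
    using metrizable_euclideanE[OF metrizable] by blast
  then interpret Metric_space UNIV d by simp
  have open_iff: "openin mtopology U \<longleftrightarrow> open U" for U
    by (simp add: top_eq)
  have open_ball: "open (mball x r)" for x r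
    using openin_mball[of x r] by (simp only: open_iff)
  have closed_cball: "closed (mcball x r)" for x r
    using closedin_mcball[of x r] by (simp add: top_eq)
  have shrink: "\<exists>y s. 0 < s \<and> mcball y s \<subseteq> U \<inter> G n \<and>
      (\<forall>a\<in>mcball y s. \<forall>b\<in>mcball y s. a - b \<in> mball 0 (1 / Suc n))"
    if "open U" "U \<noteq> {}" for U n
  proof -
    obtain y where y: "y \<in> U \<inter> G n"
      using dense_G[OF \<open>open U\<close> \<open>U \<noteq> {}\<close>] by blast
    have "((\<lambda>p. fst p - snd p) \<longlongrightarrow> y - y) (nhds (y, y))"
      using tendsto_diff[OF tendsto_fst[OF filterlim_ident[of "nhds (y, y)"]]
          tendsto_snd[OF filterlim_ident[of "nhds (y, y)"]]] by simp
    moreover have "open (mball 0 (1 / Suc n))" "y - y \<in> mball 0 (1 / Suc n)"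
      using open_ball by auto
    ultimately have "\<forall>\<^sub>F p in nhds (y, y). fst p - snd p \<in> mball 0 (1 / Suc n)"
      by (rule topological_tendstoD)
    then obtain P where P: "eventually P (nhds y)"
      "\<And>a b. P a \<Longrightarrow> P b \<Longrightarrow> a - b \<in> mball 0 (1 / Suc n)"
      unfolding nhds_prod eventually_prod_same by auto
    obtain V where V: "open V" "y \<in> V" "\<And>a. a \<in> V \<Longrightarrow> P a"
      using P(1) by (auto simp: eventually_nhds)
    have "openin mtopology (U \<inter> G n \<inter> V)"
      unfolding open_iff using \<open>open U\<close> open_G V by auto
    then obtain s where "0 < s" "mcball y s \<subseteq> U \<inter> G n \<inter> V"
      unfolding openin_mtopology_mcball using y V by blast
    with V(3) P(2) show ?thesis
      by (intro exI[of _ y] exI[of _ s]) blast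
  qed
  \<comment> \<open>A pair consists of the centre and the radius of a ball.\<close>
  define small where "small n p \<longleftrightarrow> 0 < snd p \<and> mcball (fst p) (snd p) \<subseteq> G n \<and>
      (\<forall>a\<in>mcball (fst p) (snd p). \<forall>b\<in>mcball (fst p) (snd p). a - b \<in> mball 0 (1 / Suc n))"
    for n and p :: "'z \<times> real"
  have "\<exists>f. \<forall>n. small n (f n) \<and>
      mcball (fst (f (Suc n))) (snd (f (Suc n))) \<subseteq> mcball (fst (f n)) (snd (f n))"
  proof (rule dependent_nat_choice)
    show "\<exists>p. small 0 p"
      using shrink[of UNIV 0] by (auto simp: small_def)
  next
    fix p n assume "small n p"
    then have "fst p \<in> mball (fst p) (snd p)"
      by (simp add: small_def)
    then have "mball (fst p) (snd p) \<noteq> {}" "open (mball (fst p) (snd p))"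
      using open_ball by blast+
    from shrink[OF this(2,1), of "Suc n"] obtain y s where ys: "0 < s"
      "mcball y s \<subseteq> mball (fst p) (snd p) \<inter> G (Suc n)"
      "\<forall>a\<in>mcball y s. \<forall>b\<in>mcball y s. a - b \<in> mball 0 (1 / Suc (Suc n))"
      by blast
    show "\<exists>q. small (Suc n) q \<and> mcball (fst q) (snd q) \<subseteq> mcball (fst p) (snd p)"
      by (rule exI[of _ "(y, s)"])
        (use ys mball_subset_mcball[of "fst p" "snd p"] in \<open>unfold small_def fst_conv snd_conv, blast\<close>)
  qed
  then obtain f where f: "\<And>n. small n (f n)"
    "\<And>n. mcball (fst (f (Suc n))) (snd (f (Suc n))) \<subseteq> mcball (fst (f n)) (snd (f n))"
    by blast
  define C where "C n = mcball (fst (f n)) (snd (f n))" for n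
  define x where "x n = fst (f n)" for n
  have C_mono: "C n \<subseteq> C m" if "m \<le> n" for m n
    unfolding C_def
    by (rule lift_Suc_antimono_le[of "\<lambda>n. mcball (fst (f n)) (snd (f n))", OF f(2) that])
  have x_C: "x n \<in> C m" if "m \<le> n" for m n
  proof -
    have "x n \<in> C n"
      using f(1)[of n] by (simp add: C_def x_def small_def)
    then show ?thesis
      using C_mono[OF that] by blast
  qed
  have C_G: "C n \<subseteq> G n" and C_diff: "\<And>a b. a \<in> C n \<Longrightarrow> b \<in> C n \<Longrightarrow> a - b \<in> mball 0 (1 / Suc n)" for n
    using f(1)[of n] by (auto simp: C_def small_def)
  let ?F = "filtermap x sequentially"
  have "filterlim (\<lambda>(x, y). x - y) (nhds 0) (?F \<times>\<^sub>F ?F)"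
    unfolding filterlim_def le_filter_def
  proof (intro allI impI)
    fix P :: "'z \<Rightarrow> bool" assume "eventually P (nhds 0)"
    then obtain U where U: "open U" "0 \<in> U" "\<And>a. a \<in> U \<Longrightarrow> P a"
      by (auto simp: eventually_nhds)
    then have "openin mtopology U"
      by (simp add: open_iff)
    then obtain r where r: "0 < r" "mball 0 r \<subseteq> U"
      using U(2) unfolding openin_mtopology by blast
    obtain k where k: "1 / real (Suc k) < r"
      using \<open>0 < r\<close> nat_approx_posE by metis
    have "P (a - b)" if "a \<in> C k" "b \<in> C k" for a b
    proof -
      have "a - b \<in> mball 0 r"
        using C_diff[OF that] k by auto
      then show ?thesis using r U by blast
    qed
    moreover have "\<forall>\<^sub>F a in ?F. a \<in> C k"
      unfolding eventually_filtermap using x_C by (auto simp: eventually_sequentially)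
    ultimately show "eventually P (filtermap (\<lambda>(x, y). x - y) (?F \<times>\<^sub>F ?F))"
      unfolding eventually_filtermap[of P] eventually_prod_same by auto
  qed
  moreover have "?F \<noteq> bot"
    by (simp add: filtermap_bot_iff)
  ultimately obtain z where "?F \<le> nhds z"
    using complete by blast
  then have lim: "limitin euclidean x z sequentially"
    by (simp add: filterlim_def)
  have "z \<in> C n" for n
  proof (rule limitin_closedin[OF lim])
    show "closedin euclidean (C n)"
      using closed_cball by (simp add: C_def)
    show "\<forall>\<^sub>F m in sequentially. x m \<in> C n"
      using x_C by (auto simp: eventually_sequentially)
  qed simp
  then show ?thesis
    using C_G by blast
qed

lemma (in frechet_space) tendsto_smul_zero: "(smul c \<longlongrightarrow> 0) (nhds 0)"
proof -
  have "((\<lambda>z. (c, z)) \<longlongrightarrow> (c, 0)) (nhds 0)"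
    by (intro tendsto_Pair tendsto_const filterlim_ident)
  from continuous_on_tendsto_compose[OF continuous_smul this] show ?thesis
    by simp
qed

lemma tendsto_add_left_nhds_zero:
  fixes x :: "'z::topological_ab_group_add"
  shows "((\<lambda>z. x + z) \<longlongrightarrow> x) (nhds 0)"
  using tendsto_add[OF tendsto_const[of x] filterlim_ident[of "nhds 0"]] by simp

lemma (in frechet_space) lower_semicontinuous_seminorm_tendsto_zero:
  fixes N :: "'z \<Rightarrow> real"
  assumes subadd: "\<And>x y. N (x + y) \<le> N x + N y"
    and homogeneous: "\<And>a x. N (smul a x) = norm a * N x"
    and closed_sublevel: "\<And>c. closed {z. N z \<le> c}"
  shows "(N \<longlongrightarrow> 0) (nhds 0)"
proof -
  have minus: "N (- x) = N x" for x
    using homogeneous[of "- 1" x] by simp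
  have zero: "N 0 = 0"
    using homogeneous[of 0 0] by simp
  have nonneg: "0 \<le> N x" for x
    using subadd[of x "- x"] by (simp add: minus zero)
  have "\<exists>n::nat. \<exists>U. open U \<and> U \<noteq> {} \<and> U \<subseteq> {z. N z \<le> real n}"
  proof (rule ccontr)
    assume no_interior: "\<not> ?thesis"
    have "(\<Inter>n::nat. - {z. N z \<le> real n}) \<noteq> {}"
      by (rule baire_complete_group[OF metrizable complete])
        (use closed_sublevel no_interior in \<open>auto simp: open_Compl\<close>)
    then obtain z where "\<forall>n::nat. real n < N z"
      by (auto simp: not_le)
    then show False
      using reals_Archimedean2[of "N z"] less_asym by blast
  qed
  \<comment> \<open>Translating \<open>U\<close> by \<open>- x\<close> turns the bound on \<open>U\<close> into a bound near the origin.\<close>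
  then obtain n :: nat and U x where U: "open U" "x \<in> U" "\<And>z. z \<in> U \<Longrightarrow> N z \<le> real n"
    by blast
  have bounded: "\<forall>\<^sub>F z in nhds 0. N z \<le> 2 * real n"
    using topological_tendstoD[OF tendsto_add_left_nhds_zero U(1,2)]
  proof eventually_elim
    case (elim z)
    then show ?case
      using subadd[of "- x" "x + z"] U(3)[OF U(2)] U(3)[OF elim] by (simp add: minus)
  qed
  show ?thesis
  proof (rule tendstoI)
    fix e :: real assume "0 < e"
    \<comment> \<open>Rescaling by \<open>t\<close> brings the bound \<open>2 * n\<close> below \<open>e\<close>, also for \<open>n = 0\<close>.\<close>
    define t where "t = e / (2 * real n + 1)"
    have t: "0 < t" "t * (2 * real n) < e"
      using \<open>0 < e\<close> by (auto simp: t_def field_simps)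
    have "\<forall>\<^sub>F z in nhds 0. N (smul (of_real (1 / t)) z) \<le> 2 * real n"
      using tendsto_smul_zero bounded by (auto simp: filterlim_iff)
    then show "\<forall>\<^sub>F z in nhds 0. dist (N z) 0 < e"
    proof eventually_elim
      case (elim z)
      then have "N z \<le> t * (2 * real n)"
        using t(1) by (simp add: homogeneous norm_divide field_simps)
      with t nonneg[of z] show ?case by (simp add: dist_real_def)
    qed
  qed
qed

section \<open>The Gelfand integral is a continuous functional\<close>

text \<open>Fatou's lemma needs sequences; these suffice to test closedness of the sublevel sets because
  the space is metrizable.\<close>

lemma (in frechet_space) gelfand_norm_tendsto_zero:
  assumes \<psi>: "gelfand_integrable smul M \<psi>"
  shows "((\<lambda>z. \<integral>x. norm (\<psi> x z) \<partial>M) \<longlongrightarrow> 0) (nhds 0)"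
proof (rule lower_semicontinuous_seminorm_tendsto_zero)
  have int: "integrable M (\<lambda>x. \<psi> x z)" for z
    using \<psi> by (simp add: gelfand_integrable_def)
  have meas [measurable]: "(\<lambda>x. \<psi> x z) \<in> borel_measurable M" for z
    using int[of z] by auto
  have lin: "Vector_Spaces.linear smul (*) (\<psi> x)" and cont: "continuous_on UNIV (\<psi> x)"
    if "x \<in> space M" for x
    using \<psi> that by (auto simp: gelfand_integrable_def topological_dual_def)
  show "(\<integral>x. norm (\<psi> x (y + z)) \<partial>M) \<le> (\<integral>x. norm (\<psi> x y) \<partial>M) + (\<integral>x. norm (\<psi> x z) \<partial>M)" for y z
  proof -
    have "(\<integral>x. norm (\<psi> x (y + z)) \<partial>M) \<le> (\<integral>x. norm (\<psi> x y) + norm (\<psi> x z) \<partial>M)"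
      by (rule integral_mono)
        (use int lin in \<open>auto simp: Vector_Spaces.linear_iff norm_triangle_ineq\<close>)
    then show ?thesis
      using int by simp
  qed
  show "(\<integral>x. norm (\<psi> x (smul a z)) \<partial>M) = norm a * (\<integral>x. norm (\<psi> x z) \<partial>M)" for a z
  proof -
    have "(\<integral>x. norm (\<psi> x (smul a z)) \<partial>M) = (\<integral>x. norm a * norm (\<psi> x z) \<partial>M)"
      by (rule Bochner_Integration.integral_cong) (use lin in \<open>auto simp: Vector_Spaces.linear_iff norm_mult\<close>)
    then show ?thesis by simp
  qed
  show "closed {z. (\<integral>x. norm (\<psi> x z) \<partial>M) \<le> c}" for c
  proof -
    have nn: "(\<integral>\<^sup>+x. norm (\<psi> x z) \<partial>M) = ennreal (\<integral>x. norm (\<psi> x z) \<partial>M)" for z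
      using int by (intro nn_integral_eq_integral) auto
    have sequential: "(\<integral>x. norm (\<psi> x l) \<partial>M) \<le> c"
      if le: "\<And>n. (\<integral>x. norm (\<psi> x (s n)) \<partial>M) \<le> c" and lim: "s \<longlonglongrightarrow> l" for s l
    proof -
      have "0 \<le> (\<integral>x. norm (\<psi> x (s 0)) \<partial>M)"
        by simp
      then have "0 \<le> c"
        using le[of 0] by linarith
      have "(\<integral>\<^sup>+x. norm (\<psi> x l) \<partial>M) = (\<integral>\<^sup>+x. liminf (\<lambda>n. ennreal (norm (\<psi> x (s n)))) \<partial>M)"
      proof (rule nn_integral_cong)
        fix x assume "x \<in> space M"
        then have "(\<lambda>n. \<psi> x (s n)) \<longlonglongrightarrow> \<psi> x l"
          using continuous_on_tendsto_compose[OF cont lim] by simp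
        then have "(\<lambda>n. ennreal (norm (\<psi> x (s n)))) \<longlonglongrightarrow> ennreal (norm (\<psi> x l))"
          by (intro tendsto_ennrealI tendsto_norm)
        then show "ennreal (norm (\<psi> x l)) = liminf (\<lambda>n. ennreal (norm (\<psi> x (s n))))"
          by (intro lim_imp_Liminf[symmetric]) auto
      qed
      also have "\<dots> \<le> liminf (\<lambda>n. \<integral>\<^sup>+x. norm (\<psi> x (s n)) \<partial>M)"
        by (rule nn_integral_liminf) simp
      also have "\<dots> \<le> liminf (\<lambda>n::nat. ennreal c)"
        unfolding nn using le by (intro Liminf_mono always_eventually allI ennreal_leI)
      also have "\<dots> = ennreal c"
        by (simp add: Liminf_const)
      finally show ?thesis
        unfolding nn using \<open>0 \<le> c\<close> by simp
    qed
    obtain d where "Metric_space (UNIV :: 'z set) d"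
      and top_eq: "Metric_space.mtopology (UNIV :: 'z set) d = euclidean"
      using metrizable_euclideanE[OF metrizable] by blast
    then interpret Metric_space UNIV d by simp
    have closed_iff: "closed A \<longleftrightarrow> (\<forall>s l. range s \<subseteq> A \<and> s \<longlonglongrightarrow> l \<longrightarrow> l \<in> A)" for A :: "'z set"
      using metric_closedin_iff_sequentially_closed[of A] by (simp add: top_eq)
    show ?thesis
      unfolding closed_iff mem_Collect_eq image_subset_iff using sequential by blast
  qed
qed

lemma gelfand_integral_in_topological_dual:
  assumes "frechet_space smul" and \<psi>: "gelfand_integrable smul M \<psi>" and E [measurable]: "E \<in> sets M"
  shows "gelfand_integral M \<psi> E \<in> topological_dual smul"
proof -
  interpret frechet_space smul by fact
  let ?g = "gelfand_integral M \<psi> E"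
  have int: "integrable M (\<lambda>x. \<psi> x z)" for z
    using \<psi> by (simp add: gelfand_integrable_def)
  have int_E: "set_integrable M E (\<lambda>x. \<psi> x z)" for z
    unfolding set_integrable_def using integrable_mult_indicator[OF E int] .
  have lin: "Vector_Spaces.linear smul (*) (\<psi> x)" if "x \<in> space M" for x
    using \<psi> that by (auto simp: gelfand_integrable_def topological_dual_def)
  have in_space: "x \<in> space M" if "x \<in> E" for x
    using sets.sets_into_space[OF E] that by blast
  have add: "?g (y + z) = ?g y + ?g z" for y z
  proof -
    have "?g (y + z) = (LINT x:E|M. \<psi> x y + \<psi> x z)"
      unfolding gelfand_integral_def
      by (rule set_lebesgue_integral_cong) (use lin in_space in \<open>auto simp: Vector_Spaces.linear_iff\<close>)
    then show ?thesis
      using int_E by (simp add: gelfand_integral_def)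
  qed
  have scale: "?g (smul a z) = a * ?g z" for a z
  proof -
    have "?g (smul a z) = (LINT x:E|M. a * \<psi> x z)"
      unfolding gelfand_integral_def
      by (rule set_lebesgue_integral_cong) (use lin in_space in \<open>auto simp: Vector_Spaces.linear_iff\<close>)
    then show ?thesis
      by (simp add: gelfand_integral_def)
  qed
  have vs: "vector_space ((*) :: 'a \<Rightarrow> 'a \<Rightarrow> 'a)"
    by unfold_locales (auto simp: algebra_simps)
  have linear: "Vector_Spaces.linear smul (*) ?g"
    unfolding Vector_Spaces.linear_iff using vector_space_axioms vs add scale by blast
  have bound: "norm (?g z) \<le> (\<integral>x. norm (\<psi> x z) \<partial>M)" for z
  proof -
    have "norm (?g z) \<le> (\<integral>x. norm (indicator E x *\<^sub>R \<psi> x z) \<partial>M)"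
      unfolding gelfand_integral_def set_lebesgue_integral_def by (rule integral_norm_bound)
    also have "\<dots> \<le> (\<integral>x. norm (\<psi> x z) \<partial>M)"
      using integrable_norm[OF int_E[unfolded set_integrable_def]] int
      by (intro integral_mono) (auto simp: indicator_def)
    finally show ?thesis .
  qed
  have zero: "(?g \<longlongrightarrow> 0) (nhds 0)"
    by (rule tendsto_norm_zero_cancel,
        rule tendsto_sandwich[OF _ _ tendsto_const gelfand_norm_tendsto_zero[OF \<psi>]])
      (use bound in auto)
  have "(?g \<longlongrightarrow> ?g y) (nhds y)" for y
  proof -
    have "((\<lambda>z. z - y) \<longlongrightarrow> 0) (nhds y)"
      using tendsto_diff[OF filterlim_ident[of "nhds y"] tendsto_const[of y]] by simp
    from filterlim_compose[OF zero this] have "((\<lambda>z. ?g (z - y)) \<longlongrightarrow> 0) (nhds y)" .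
    moreover have "?g (z - y) = ?g z - ?g y" for z
      using add[of "z - y" y] by simp
    ultimately show ?thesis
      by (simp add: LIM_zero_iff)
  qed
  then have "continuous_on UNIV ?g"
    by (simp add: continuous_on_def tendsto_at_iff_tendsto_nhds)
  with linear show ?thesis
    by (simp add: topological_dual_def)
qed

section \<open>Weak star continuity\<close>

lemma norm_set_integral_diff_le:
  fixes f :: "'a \<Rightarrow> 'b::{banach, second_countable_topology}"
  assumes f: "integrable M f" and E [measurable]: "E \<in> sets M" and F [measurable]: "F \<in> sets M"
  shows "norm ((LINT x:F|M. f x) - (LINT x:E|M. f x)) \<le> (LINT x:sym_diff E F|M. norm (f x))"
proof -
  have int: "integrable M (\<lambda>x. indicator A x *\<^sub>R f x)" if "A \<in> sets M" for A
    using integrable_mult_indicator[OF that f] .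
  have "(LINT x:F|M. f x) - (LINT x:E|M. f x) =
      (\<integral>x. indicator F x *\<^sub>R f x - indicator E x *\<^sub>R f x \<partial>M)"
    unfolding set_lebesgue_integral_def using int E F by simp
  also have "norm \<dots> \<le> (\<integral>x. norm (indicator F x *\<^sub>R f x - indicator E x *\<^sub>R f x) \<partial>M)"
    by (rule integral_norm_bound)
  also have "\<dots> = (LINT x:sym_diff E F|M. norm (f x))"
    unfolding set_lebesgue_integral_def
    by (rule Bochner_Integration.integral_cong) (auto simp: indicator_def)
  finally show ?thesis .
qed

theorem proposition3p4:
  fixes M :: "'m measure"
    and smul :: "'k::real_or_complex \<Rightarrow> 'z::topological_ab_group_add \<Rightarrow> 'z"
    and \<psi> :: "'m \<Rightarrow> 'z \<Rightarrow> 'k"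
  assumes "sigma_finite_measure M"
    and "frechet_space smul"
    and "gelfand_integrable smul M \<psi>"
  shows "continuous_map (frechet_nikodym_topology M) (weak_star_topology smul)
    (gelfand_integral_class M \<psi>)"
proof -
  note \<psi> = assms(3)
  let ?cls = "\<lambda>E. null_diff_rel M `` {E}"
  have rep: "\<exists>E\<in>sets M. A = ?cls E" if "A \<in> frechet_nikodym_space M" for A
    using that by (auto simp: frechet_nikodym_space_def elim!: quotientE)
  have dual: "gelfand_integral_class M \<psi> A \<in> topological_dual smul"
    if "A \<in> frechet_nikodym_space M" for A
    using rep[OF that] gelfand_integral_class_class[OF \<psi>]
      gelfand_integral_in_topological_dual[OF assms(2) \<psi>] by auto
  show ?thesis
    unfolding weak_star_topology_def
  proof (rule continuous_on_generated_topo)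
    fix W assume "W \<in> {{f \<in> topological_dual smul. f z \<in> U} | z U. open U}"
    then obtain z U where W: "W = {f \<in> topological_dual smul. f z \<in> U}" and "open U"
      by blast
    have int: "integrable M (\<lambda>x. \<psi> x z)"
      using \<psi> by (simp add: gelfand_integrable_def)
    have "\<exists>e>0. \<forall>B\<in>frechet_nikodym_space M. frechet_nikodym_dist M A B < e \<longrightarrow>
        gelfand_integral_class M \<psi> B z \<in> U"
      if A: "A \<in> frechet_nikodym_space M" and A_U: "gelfand_integral_class M \<psi> A z \<in> U" for A
    proof -
      obtain E where E: "E \<in> sets M" "A = ?cls E"
        using rep[OF A] by blast
      obtain r where r: "0 < r" "ball (gelfand_integral_class M \<psi> A z) r \<subseteq> U"
        using \<open>open U\<close> A_U by (meson openE)
      obtain d where d: "0 < d" "\<And>D. D \<in> sets M \<Longrightarrow> emeasure M D < ennreal d \<Longrightarrow>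
          (LINT x:D|M. norm (\<psi> x z)) < r"
        using integral_absolutely_continuous[OF integrable_norm[OF int] norm_ge_zero r(1)] by blast
      have "gelfand_integral_class M \<psi> B z \<in> U"
        if B: "B \<in> frechet_nikodym_space M" and close: "frechet_nikodym_dist M A B < ennreal d" for B
      proof -
        obtain F where F: "F \<in> sets M" "B = ?cls F"
          using rep[OF B] by blast
        have "emeasure M (sym_diff E F) < ennreal d"
          using close E F by (simp add: frechet_nikodym_dist_class)
        then have "(LINT x:sym_diff E F|M. norm (\<psi> x z)) < r"
          using d(2)[of "sym_diff E F"] E F by blast
        then have "norm (gelfand_integral M \<psi> F z - gelfand_integral M \<psi> E z) < r"
          using norm_set_integral_diff_le[OF int E(1) F(1)] by (simp add: gelfand_integral_def)
        then show ?thesis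
          using r(2) E F gelfand_integral_class_class[OF \<psi>]
          by (auto simp: subset_iff dist_norm norm_minus_commute)
      qed
      with \<open>0 < d\<close> show ?thesis
        by (intro exI[of _ "ennreal d"]) auto
    qed
    then show "openin (frechet_nikodym_topology M)
        (gelfand_integral_class M \<psi> -` W \<inter> topspace (frechet_nikodym_topology M))"
      unfolding openin_frechet_nikodym_topology W using dual by fastforce
  next
    show "gelfand_integral_class M \<psi> ` topspace (frechet_nikodym_topology M) \<subseteq>
        \<Union> {{f \<in> topological_dual smul. f z \<in> U} | z U. open U}"
      using dual by auto
  qed
qed

end
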